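(* Let $P\subset\mathbb{R}^d$ be a polytope and $\eta$ a normalization. There is a polytope $\Gamma^{\eta}_{P}\subset\mathbb{R}^d$, called the neighbotope of $P$ and $\eta$, such that the following holds: for any generic objective functions $c,c'\in\mathbb{R}^d$ $$\mathcal{B}^\eta_P(c)=\mathcal{B}^\eta_P(c')\quad\Longleftrightarrow\quad(\Gamma^\eta_P)^{c}=(\Gamma^\eta_P)^{c'}.$$
   Context: For a polytope $P\subset\mathbb{R}^d$, $V(P)$ denotes its vertex set, $E(P)$ its edges, $G(P)=(V(P),E(P))$ its graph, and $\mathrm{Nb}_P(v)$ the set of vertices adjacent to $v$. A normalization is a function $\eta:\mathbb{R}^d\to\mathbb{R}$ (such that the quotients below are defined). An objective function $c\in\mathbb{R}^d$ is generic if $c^tu\neq c^tv$ for all edges $uv$ (so there is a unique maximizing vertex $v_{opt}$) and the maxima below are uniquely attained. For generic $c$, $\mathcal{B}^\eta_P(c):V(P)\to V(P)$ is the arborescence obtained from the normalized-weight pivot rule with normalization $\eta$ (independent of $c$) and weight $c$: it fixes $v_{opt}$ and sends each $v\neq v_{opt}$ to $$\operatorname{argmax}\left\{\frac{c^t(u-v)}{\eta(u-v)} : u\in\mathrm{Nb}_P(v),\ c^tu>c^tv\right\}.$$ The neighbotope is defined as follows. An arborescence on the undirected graph $G(P)$ is a map $\mathcal{B}:V(P)\to V(P)$ such that there is a unique vertex $r$ with $\mathcal{B}(r)=r$, $\mathcal{B}(v)\in\mathrm{Nb}_P(v)$ for all $v\ne r$, and for every $v$ there is $k\ge1$ with $\mathcal{B}^k(v)=r$.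 Put $\psi^\eta(\mathcal{B})=\sum_{v\in V(P)}\frac{\mathcal{B}(v)-v}{\eta(\mathcal{B}(v)-v)}$ with the convention $\frac{0}{\eta(0)}=0$. Then $$\Gamma^\eta_P=\operatorname{conv}\{\psi^\eta(\mathcal{B}) : \mathcal{B}\text{ an arborescence of }G(P)\}.$$ For a polytope $Q\subset\mathbb{R}^d$ and $c\in\mathbb{R}^d$, $Q^c$ is the face of $Q$ on which $x\mapsto c^tx$ is maximal.
   Formalization: The normalization η is assumed positive on all edge directions u−v of P, not merely nonzero; for a triangle with η = −1 the stated equivalence fails. *)

theory Defs
  imports "HOL-Analysis.Analysis"
begin

definition verts :: "'a::euclidean_space set \<Rightarrow> 'a set" where
  "verts P = {v. v extreme_point_of P}"

definition Nb :: "'a::euclidean_space set \<Rightarrow> 'a \<Rightarrow> 'a set" where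
  "Nb P v = {u \<in> verts P. closed_segment v u edge_of P}"

text \<open>
  For the quotients in the pivot rule to be normalized weights, \<open>\<eta>\<close> has to be positive (not just
  nonzero) on the edge directions: with a negative sign the rule would compare improving
  neighbors in the reverse order. The two orientations of an edge may have different values.
\<close>

definition normalization :: "'a::euclidean_space set \<Rightarrow> ('a \<Rightarrow> real) \<Rightarrow> bool" where
  "normalization P \<eta> \<longleftrightarrow> (\<forall>v \<in> verts P. \<forall>u \<in> Nb P v. \<eta> (u - v) > 0)"

definition improving :: "'a::euclidean_space set \<Rightarrow> 'a \<Rightarrow> 'a \<Rightarrow> 'a set" where
  "improving P c v = {u \<in> Nb P v. c \<bullet> u > c \<bullet> v}"

definition slope :: "('a::euclidean_space \<Rightarrow> real) \<Rightarrow> 'a \<Rightarrow> 'a \<Rightarrow> 'a \<Rightarrow> real" where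
  "slope \<eta> c v u = (c \<bullet> (u - v)) / \<eta> (u - v)"

definition v_opt :: "'a::euclidean_space set \<Rightarrow> 'a \<Rightarrow> 'a" where
  "v_opt P c = arg_max_on (\<lambda>v. c \<bullet> v) (verts P)"

definition generic :: "'a::euclidean_space set \<Rightarrow> ('a \<Rightarrow> real) \<Rightarrow> 'a \<Rightarrow> bool" where
  "generic P \<eta> c \<longleftrightarrow>
     (\<forall>v \<in> verts P. \<forall>u \<in> Nb P v. c \<bullet> u \<noteq> c \<bullet> v) \<and>
     (\<forall>v \<in> verts P. v \<noteq> v_opt P c \<longrightarrow>
        (\<exists>!u. is_arg_max (slope \<eta> c v) (\<lambda>u. u \<in> improving P c v) u))"

text \<open>
  Maps \<open>V(P) \<rightarrow> V(P)\<close> are extensional functions (\<open>undefined\<close> outside \<^term>\<open>verts P\<close>), so that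
  equality of HOL functions is equality on the vertices.
\<close>

definition pivot_arb :: "'a::euclidean_space set \<Rightarrow> ('a \<Rightarrow> real) \<Rightarrow> 'a \<Rightarrow> 'a \<Rightarrow> 'a" where
  "pivot_arb P \<eta> c =
     (\<lambda>v \<in> verts P. if v = v_opt P c then v
                    else arg_max_on (slope \<eta> c v) (improving P c v))"

definition arborescence :: "'a::euclidean_space set \<Rightarrow> ('a \<Rightarrow> 'a) \<Rightarrow> bool" where
  "arborescence P B \<longleftrightarrow>
     B \<in> verts P \<rightarrow>\<^sub>E verts P \<and>
     (\<exists>r \<in> verts P. B r = r \<and> (\<forall>s \<in> verts P. B s = s \<longrightarrow> s = r) \<and>
        (\<forall>v \<in> verts P. v \<noteq> r \<longrightarrow> B v \<in> Nb P v) \<and>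
        (\<forall>v \<in> verts P. \<exists>k\<ge>1. (B ^^ k) v = r))"

text \<open>
  The summand of the root is \<open>0\<close> whatever the value \<open>\<eta> 0\<close>, as required by the convention
  \<open>0 / \<eta> 0 = 0\<close>.
\<close>

definition psi :: "'a::euclidean_space set \<Rightarrow> ('a \<Rightarrow> real) \<Rightarrow> ('a \<Rightarrow> 'a) \<Rightarrow> 'a" where
  "psi P \<eta> B = (\<Sum>v \<in> verts P. (B v - v) /\<^sub>R \<eta> (B v - v))"

definition neighbotope :: "'a::euclidean_space set \<Rightarrow> ('a \<Rightarrow> real) \<Rightarrow> 'a set" where
  "neighbotope P \<eta> = convex hull {psi P \<eta> B | B. arborescence P B}"

definition max_face :: "'a::euclidean_space set \<Rightarrow> 'a \<Rightarrow> 'a set" where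
  "max_face Q c = {x \<in> Q. \<forall>y \<in> Q. c \<bullet> y \<le> c \<bullet> x}"

end

theory Submission
  imports Defs
begin

text \<open>
  For generic \<open>c\<close>, the map \<open>pivot_arb P \<eta> c\<close> maximizes each summand \<open>slope \<eta> c v (B v)\<close> of
  \<open>c \<bullet> psi P \<eta> B\<close> separately, and strictly so at every vertex. As it is itself an arborescence,
  the face of the neighbotope in direction \<open>c\<close> is the single point \<open>psi P \<eta> (pivot_arb P \<eta> c)\<close>,
  and \<open>pivot_arb P \<eta> c\<close> is the only arborescence mapped to that point.
\<close>

text \<open>The open half-space strictly below \<open>x\<close> stays convex when its boundary point
  \<open>x\<close> is added. The enlarged set contains \<open>S\<close>, hence its hull, and
  \<open>x\<close> is its only point where \<open>c\<close> takes the value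
  \<open>c \<bullet> x\<close>.\<close>

lemma max_face_convex_hull_unique:
  assumes "x \<in> S" and less: "\<And>y. y \<in> S \<Longrightarrow> y \<noteq> x \<Longrightarrow> c \<bullet> y < c \<bullet> x"
  shows "max_face (convex hull S) c = {x}"
proof -
  let ?H = "insert x {y. c \<bullet> y < c \<bullet> x}"
  have "convex ?H"
  proof (rule convexI)
    fix y z :: 'a and s t :: real
    assume yz: "y \<in> ?H" "z \<in> ?H" and st: "0 \<le> s" "0 \<le> t" "s + t = 1"
    show "s *\<^sub>R y + t *\<^sub>R z \<in> ?H"
    \<comment> \<open>If a weight vanishes or both points are \<open>x\<close>, the combination is
      one of the two points. Otherwise both weights are positive and some point lies strictly below
      \<open>x\<close>, which makes the estimate strict.\<close>
    proof (cases "s = 0 \<or> t = 0 \<or> (y = x \<and> z = x)")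
      case True
      then show ?thesis
        using yz st by (auto simp flip: scaleR_add_left)
    next
      case False
      with st have pos: "0 < s" "0 < t" by auto
      have "c \<bullet> (s *\<^sub>R y + t *\<^sub>R z) = s * (c \<bullet> y) + t * (c \<bullet> z)"
        by (simp add: inner_add_right)
      also have "\<dots> < s * (c \<bullet> x) + t * (c \<bullet> x)"
      proof (cases "y = x")
        case True
        then show ?thesis using False yz pos by auto
      next
        case False
        then have "s * (c \<bullet> y) < s * (c \<bullet> x)" using yz pos by auto
        moreover have "t * (c \<bullet> z) \<le> t * (c \<bullet> x)" using yz pos by auto
        ultimately show ?thesis by linarith
      qed
      also have "\<dots> = c \<bullet> x"
        using st by (simp flip: distrib_right)
      finally show ?thesis by simp
    qed
  qed
  moreover have "S \<subseteq> ?H"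
    using less by auto
  ultimately have "convex hull S \<subseteq> ?H"
    by (rule hull_minimal[rotated])
  moreover have "x \<in> convex hull S"
    using \<open>x \<in> S\<close> by (rule hull_inc)
  ultimately show ?thesis
    unfolding max_face_def by fastforce
qed

lemma inner_psi: "c \<bullet> psi P \<eta> B = (\<Sum>v\<in>verts P. slope \<eta> c v (B v))"
  unfolding psi_def slope_def by (simp add: inner_sum_right divide_inverse mult.commute)

lemma finite_verts: "polytope P \<Longrightarrow> finite (verts P)"
  unfolding verts_def by (intro finite_polyhedron_extreme_points polytope_imp_polyhedron)

lemma finite_arborescences:
  assumes "finite (verts P)"
  shows "finite {B. arborescence P B}"
proof (rule finite_subset)
  show "{B. arborescence P B} \<subseteq> verts P \<rightarrow>\<^sub>E verts P"
    unfolding arborescence_def by auto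
  show "finite (verts P \<rightarrow>\<^sub>E verts P)"
    using assms by (intro finite_PiE)
qed

lemma polytope_neighbotope:
  assumes "finite (verts P)"
  shows "polytope (neighbotope P \<eta>)"
proof -
  have "{psi P \<eta> B | B. arborescence P B} = psi P \<eta> ` {B. arborescence P B}"
    by auto
  then show ?thesis
    using finite_arborescences[OF assms] unfolding neighbotope_def polytope_def by (metis finite_imageI)
qed

lemma v_opt:
  assumes "finite (verts P)" "verts P \<noteq> {}"
  shows "v_opt P c \<in> verts P" and "\<And>v. v \<in> verts P \<Longrightarrow> c \<bullet> v \<le> c \<bullet> v_opt P c"
proof -
  have "Max ((\<bullet>) c ` verts P) \<in> (\<bullet>) c ` verts P"
    using assms by (intro Max_in) auto
  then obtain m where "m \<in> verts P" "c \<bullet> m = Max ((\<bullet>) c ` verts P)"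
    by auto
  then have "m \<in> verts P" "\<forall>v\<in>verts P. c \<bullet> v \<le> c \<bullet> m"
    using assms by auto
  then have "is_arg_max ((\<bullet>) c) (\<lambda>v. v \<in> verts P) m"
    by (auto simp: is_arg_max_linorder)
  then have "is_arg_max ((\<bullet>) c) (\<lambda>v. v \<in> verts P) (v_opt P c)"
    unfolding v_opt_def arg_max_on_def arg_max_def by (rule someI)
  then show "v_opt P c \<in> verts P" and "\<And>v. v \<in> verts P \<Longrightarrow> c \<bullet> v \<le> c \<bullet> v_opt P c"
    by (auto simp: is_arg_max_linorder)
qed

text \<open>The existence half of \<open>\<exists>!\<close> in \<open>generic\<close> supplies an
  improving neighbor at each non-optimal vertex, so the choice behind \<open>arg_max_on\<close>
  yields a genuine maximizer.\<close>

lemma pivot_arb_is_arg_max: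
  assumes "generic P \<eta> c" "v \<in> verts P" "v \<noteq> v_opt P c"
  shows "is_arg_max (slope \<eta> c v) (\<lambda>u. u \<in> improving P c v) (pivot_arb P \<eta> c v)"
proof -
  have "\<exists>u. is_arg_max (slope \<eta> c v) (\<lambda>u. u \<in> improving P c v) u"
    using assms unfolding generic_def by blast
  then show ?thesis
    using assms unfolding pivot_arb_def arg_max_on_def arg_max_def by (simp add: someI_ex)
qed

lemma pivot_arb_improving:
  assumes "generic P \<eta> c" "v \<in> verts P" "v \<noteq> v_opt P c"
  shows "pivot_arb P \<eta> c v \<in> improving P c v"
  using pivot_arb_is_arg_max[OF assms] by (simp add: is_arg_max_def)

text \<open>At every vertex other than the optimum, a pivot step strictly increases
  \<open>c\<close>. This excludes further fixed points, and as there are finitely many vertices,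
  iteration ends at the optimum. The induction counts the vertices strictly above
  \<open>v\<close>.\<close>

lemma arborescence_pivot_arb:
  assumes fin: "finite (verts P)" and ne: "verts P \<noteq> {}" and gen: "generic P \<eta> c"
  shows "arborescence P (pivot_arb P \<eta> c)"
proof -
  let ?B = "pivot_arb P \<eta> c" and ?r = "v_opt P c"
  have r: "?r \<in> verts P" "?B ?r = ?r"
    using v_opt(1)[OF fin ne] by (simp_all add: pivot_arb_def)
  have step: "?B v \<in> Nb P v" "?B v \<in> verts P" "c \<bullet> v < c \<bullet> ?B v"
    if "v \<in> verts P" "v \<noteq> ?r" for v
    using pivot_arb_improving[OF gen that] by (auto simp: improving_def Nb_def)
  have "\<exists>k\<ge>1. (?B ^^ k) v = ?r" if "v \<in> verts P" for v
    using that
  proof (induction "card {w \<in> verts P. c \<bullet> v < c \<bullet> w}" arbitrary: v rule: less_induct)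
    case less
    show ?case
    proof (cases "v = ?r")
      case True
      \<comment> \<open>The definition asks for \<open>k \<ge> 1\<close>; the optimum is fixed, so
        one iteration stays there.\<close>
      then show ?thesis using r by (intro exI[of _ 1]) simp
    next
      case False
      note B = step[OF less.prems False]
      \<comment> \<open>The inclusion is strict because \<open>?B v\<close> belongs to the
        right-hand set only.\<close>
      have "{w \<in> verts P. c \<bullet> ?B v < c \<bullet> w} \<subset> {w \<in> verts P. c \<bullet> v < c \<bullet> w}"
        using B by auto
      then have "card {w \<in> verts P. c \<bullet> ?B v < c \<bullet> w} < card {w \<in> verts P. c \<bullet> v < c \<bullet> w}"
        using fin by (intro psubset_card_mono) auto
      from less.hyps[OF this B(2)] obtain k where "(?B ^^ k) (?B v) = ?r"
        by blast
      then show ?thesis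
        by (intro exI[of _ "Suc k"]) (simp add: funpow_swap1)
    qed
  qed
  moreover have "?B \<in> verts P \<rightarrow>\<^sub>E verts P"
    using step(2) r by (auto simp: PiE_iff) (auto simp: pivot_arb_def)
  moreover have "v = ?r" if "v \<in> verts P" "?B v = v" for v
    using step(3)[OF that(1)] that(2) by auto
  ultimately show ?thesis
    unfolding arborescence_def using r step(1) by blast
qed

text \<open>The alternative \<open>w = v\<close> is included because a competing arborescence may
  have its root at any vertex. Positivity of \<open>\<eta>\<close> makes the sign of a slope tell
  whether the neighbor is improving.\<close>

lemma slope_less_slope_pivot_arb:
  assumes fin: "finite (verts P)" and norm: "normalization P \<eta>" and gen: "generic P \<eta> c"
    and v: "v \<in> verts P" and w: "w = v \<or> w \<in> Nb P v" "w \<noteq> pivot_arb P \<eta> c v"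
  shows "slope \<eta> c v w < slope \<eta> c v (pivot_arb P \<eta> c v)"
proof (cases "v = v_opt P c")
  case True
  then have [simp]: "pivot_arb P \<eta> c v = v"
    using v by (simp add: pivot_arb_def)
  \<comment> \<open>At the optimum the pivot map stays put with slope 0, and every neighbor has
    negative slope.\<close>
  have "w \<in> Nb P v" using w by simp
  then have "w \<in> verts P" "\<eta> (w - v) > 0" "c \<bullet> w \<noteq> c \<bullet> v"
    using norm gen v unfolding normalization_def generic_def Nb_def by auto
  moreover have "c \<bullet> w \<le> c \<bullet> v"
    using v_opt(2)[OF fin _ \<open>w \<in> verts P\<close>, of c] v True by auto
  ultimately show ?thesis
    by (simp add: slope_def inner_diff_right divide_neg_pos)
next
  case False
  let ?u = "pivot_arb P \<eta> c v"
  have max: "is_arg_max (slope \<eta> c v) (\<lambda>u. u \<in> improving P c v) ?u"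
    by (rule pivot_arb_is_arg_max[OF gen v False])
  show ?thesis
  proof (cases "w \<in> improving P c v")
    case True
    \<comment> \<open>Uniqueness of the maximizer turns the weak inequality for improving neighbors
      into a strict one.\<close>
    have "\<not> is_arg_max (slope \<eta> c v) (\<lambda>u. u \<in> improving P c v) w"
      using gen v False max w(2) unfolding generic_def by blast
    then show ?thesis
      using max True by (force simp: is_arg_max_linorder)
  next
    case nimp: False
    have "?u \<in> Nb P v" "c \<bullet> v < c \<bullet> ?u"
      using max by (auto simp: is_arg_max_def improving_def)
    then have "0 < slope \<eta> c v ?u"
      using norm v by (simp add: normalization_def slope_def inner_diff_right)
    moreover have "slope \<eta> c v w \<le> 0"
    \<comment> \<open>For \<open>w = v\<close> the numerator is 0, so the slope is 0 whatever
      \<open>\<eta> 0\<close> is.\<close>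
    proof (cases "w = v")
      case False
      then have "w \<in> Nb P v" using w by simp
      then have "\<eta> (w - v) > 0" "c \<bullet> w \<le> c \<bullet> v"
        using norm v nimp by (auto simp: normalization_def improving_def)
      then show ?thesis
        by (simp add: slope_def inner_diff_right divide_nonpos_pos)
    qed (simp add: slope_def)
    ultimately show ?thesis by linarith
  qed
qed

text \<open>Assuming that the maps differ, rather than their images under \<open>psi\<close>, lets
  this serve twice: for the uniqueness of the maximal point and for recovering the pivot map from
  that point.\<close>

lemma inner_psi_less_pivot_arb:
  assumes fin: "finite (verts P)" and norm: "normalization P \<eta>" and gen: "generic P \<eta> c"
    and B: "arborescence P B" "B \<noteq> pivot_arb P \<eta> c"
  shows "c \<bullet> psi P \<eta> B < c \<bullet> psi P \<eta> (pivot_arb P \<eta> c)"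
proof -
  let ?A = "pivot_arb P \<eta> c"
  have ext: "B \<in> extensional (verts P)" "?A \<in> extensional (verts P)"
    using B(1) by (auto simp: arborescence_def PiE_iff pivot_arb_def)
  have "B v = v \<or> B v \<in> Nb P v" if "v \<in> verts P" for v
    using B(1) that unfolding arborescence_def by metis
  then have less: "slope \<eta> c v (B v) < slope \<eta> c v (?A v)" if "v \<in> verts P" "B v \<noteq> ?A v" for v
    using slope_less_slope_pivot_arb[OF fin norm gen] that by blast
  \<comment> \<open>Both maps are extensional, so being distinct they differ at some vertex, where
    the strict inequality applies.\<close>
  moreover obtain v where "v \<in> verts P" "B v \<noteq> ?A v"
    using B(2) extensionalityI[OF ext] by blast
  moreover have "slope \<eta> c v (B v) \<le> slope \<eta> c v (?A v)" if "v \<in> verts P" for v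
    using less[OF that] by (cases "B v = ?A v") auto
  ultimately have "(\<Sum>v\<in>verts P. slope \<eta> c v (B v)) < (\<Sum>v\<in>verts P. slope \<eta> c v (?A v))"
    using fin by (intro sum_strict_mono_ex1) blast+
  then show ?thesis
    by (simp add: inner_psi)
qed

lemma max_face_neighbotope:
  assumes "finite (verts P)" "verts P \<noteq> {}" "normalization P \<eta>" "generic P \<eta> c"
  shows "max_face (neighbotope P \<eta>) c = {psi P \<eta> (pivot_arb P \<eta> c)}"
  unfolding neighbotope_def
proof (rule max_face_convex_hull_unique)
  show "psi P \<eta> (pivot_arb P \<eta> c) \<in> {psi P \<eta> B | B. arborescence P B}"
    using arborescence_pivot_arb assms by blast
  fix y
  assume "y \<in> {psi P \<eta> B | B. arborescence P B}" "y \<noteq> psi P \<eta> (pivot_arb P \<eta> c)"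
  then show "c \<bullet> y < c \<bullet> psi P \<eta> (pivot_arb P \<eta> c)"
    using inner_psi_less_pivot_arb assms by blast
qed

theorem theorem1p5:
  fixes P :: "(real ^ 'd) set" and \<eta> :: "real ^ 'd \<Rightarrow> real"
  assumes "polytope P" and "normalization P \<eta>"
  shows "polytope (neighbotope P \<eta>) \<and>
    (\<forall>c c' :: real ^ 'd. generic P \<eta> c \<longrightarrow> generic P \<eta> c' \<longrightarrow>
       (pivot_arb P \<eta> c = pivot_arb P \<eta> c' \<longleftrightarrow>
        max_face (neighbotope P \<eta>) c = max_face (neighbotope P \<eta>) c'))"
proof (intro conjI allI impI)
  have fin: "finite (verts P)"
    using assms(1) by (rule finite_verts)
  then show "polytope (neighbotope P \<eta>)"
    by (rule polytope_neighbotope)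
  fix c c' :: "real ^ 'd"
  assume gen: "generic P \<eta> c" "generic P \<eta> c'"
  show "pivot_arb P \<eta> c = pivot_arb P \<eta> c' \<longleftrightarrow>
    max_face (neighbotope P \<eta>) c = max_face (neighbotope P \<eta>) c'"
  proof (cases "verts P = {}")
    case True
    \<comment> \<open>Without vertices there is no root, hence no arborescence.\<close>
    then have "neighbotope P \<eta> = {}"
      by (auto simp: neighbotope_def arborescence_def)
    with True show ?thesis
      by (simp add: pivot_arb_def max_face_def restrict_def)
  next
    case False
    \<comment> \<open>The pivot map of \<open>c'\<close> is a competitor for \<open>c\<close>: if it
      differed from that of \<open>c\<close>, its point would have strictly smaller
      \<open>c\<close>-value.\<close>
    have "pivot_arb P \<eta> c = pivot_arb P \<eta> c'"
      if "psi P \<eta> (pivot_arb P \<eta> c) = psi P \<eta> (pivot_arb P \<eta> c')"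
      using inner_psi_less_pivot_arb[OF fin assms(2) gen(1) arborescence_pivot_arb[OF fin False gen(2)]]
        that by force
    then show ?thesis
      using max_face_neighbotope[OF fin False assms(2)] gen by auto
  qed
qed

end
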